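(* Let $1\le N<L$ be integers and $0<p<1$. Let $z,z'\in\mathbb C$ be nonzero with $(z')^L\ne z^L$. Let $\vec w=(w_1,\dots,w_N)\in(\mathcal S_z)^N$ and $\vec w'=(w_1',\dots,w_N')\in(\mathcal S_{z'})^N$ satisfy $\prod_{j=1}^N|w_j+1|>\prod_{j=1}^N|w_j'+1|$. Then $$\sum_{\vec x\in\mathcal X_N^{(L)},\ x_N\ge0}\Psi^r_{\vec x}(\vec w)\Psi^\ell_{\vec x}(\vec w')=\Big(1-\Big(\frac{z'}z\Big)^L\Big)^{N-1}\prod_{j=1}^N(w_j+1)\cdot\det\Big[\frac1{w_i-w'_{i'}}\Big]_{i,i'=1}^N.$$
   Context: $\mathcal X_N^{(L)}=\{(x_1,\dots,x_N)\in\mathbb Z^N:x_N+L>x_1>\cdots>x_N\}$. $\mathcal S_z=\{w\in\mathbb C:w^N(1+w)^{L-N}=z^L(1+pw)^N\}$. For $\vec x\in\mathcal X_N^{(L)}$, with $x_0:=x_N+L$, $$\Psi^\ell_{\vec x}(\vec w)=\det\Big[\Big(\frac{w_i}{1+pw_i}\Big)^{j-1}(1+w_i)^{x_{N-j+1}-j+1}\Big]_{i,j=1}^N,$$ $$\Psi^r_{\vec x}(\vec w)=\prod_{i=1}^N(1-p\mathbf 1_{x_{i-1}-x_i=1})\cdot\det\Big[\Big(\frac{w_i}{1+pw_i}\Big)^{1-j}(1+w_i)^{-x_{N-j+1}+j-1}\Big]_{i,j=1}^N.$$ *)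

theory Defs
  imports
    "HOL-Analysis.Infinite_Sum"
    "HOL-Library.FuncSet"
    "Jordan_Normal_Form.Determinant"
begin

text \<open>An N-tuple is a function on the index set \<open>{1..N}\<close>. Configurations are required to be
  \<^const>\<open>extensional\<close>, so that each integer vector is represented by exactly one function and is
  summed over exactly once.\<close>

definition configs :: "nat \<Rightarrow> nat \<Rightarrow> (nat \<Rightarrow> int) set" where
  "configs N L = {x \<in> extensional {1..N}.
     x N + int L > x 1 \<and> (\<forall>i\<in>{1..<N}. x i > x (Suc i))}"

definition with_x0 :: "nat \<Rightarrow> nat \<Rightarrow> (nat \<Rightarrow> int) \<Rightarrow> nat \<Rightarrow> int" where
  "with_x0 N L x = x(0 := x N + int L)"

definition bethe_roots :: "real \<Rightarrow> nat \<Rightarrow> nat \<Rightarrow> complex \<Rightarrow> complex set" where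
  "bethe_roots p N L z =
     {w. w ^ N * (1 + w) ^ (L - N) = z ^ L * (1 + complex_of_real p * w) ^ N}"

text \<open>Matrices of type \<^typ>\<open>'a mat\<close> are indexed from 0, hence the shift.\<close>

definition det1 :: "nat \<Rightarrow> (nat \<Rightarrow> nat \<Rightarrow> complex) \<Rightarrow> complex" where
  "det1 N a = det (mat N N (\<lambda>(i, j). a (Suc i) (Suc j)))"

definition Psi_l :: "real \<Rightarrow> nat \<Rightarrow> (nat \<Rightarrow> int) \<Rightarrow> (nat \<Rightarrow> complex) \<Rightarrow> complex" where
  "Psi_l p N x w = det1 N (\<lambda>i j.
     (w i / (1 + complex_of_real p * w i)) powi (int j - 1)
       * (1 + w i) powi (x (N + 1 - j) - int j + 1))"

definition Psi_r :: "real \<Rightarrow> nat \<Rightarrow> nat \<Rightarrow> (nat \<Rightarrow> int) \<Rightarrow> (nat \<Rightarrow> complex) \<Rightarrow> complex" where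
  "Psi_r p N L x w =
     (\<Prod>i = 1..N. 1 - complex_of_real p * of_bool (with_x0 N L x (i - 1) - x i = 1))
     * det1 N (\<lambda>i j.
         (w i / (1 + complex_of_real p * w i)) powi (1 - int j)
           * (1 + w i) powi (- x (N + 1 - j) + int j - 1))"

end

theory Submission
  imports Defs "HOL-Library.Function_Algebras"
begin

text \<open>
  Number the particles from the lowest position upwards, \<open>y\<^sub>j = x\<^sub>N\<^sub>-\<^sub>j\<close> for \<open>j = 0, \<dots>, N - 1\<close>, and put
  \<open>\<phi>\<^sub>j(y)(v) = (v / (1 + p v))\<^sup>j (1 + v)\<^bsup>y-j\<^esup>\<close> and \<open>\<psi>\<^sub>j(y)(u) = 1 / \<phi>\<^sub>j(y)(u)\<close>. The two Bethe
  functions are \<open>det[\<phi>\<^sub>j(y\<^sub>j)(v\<^sub>i)]\<close> and, up to the weight, \<open>det[\<psi>\<^sub>j(y\<^sub>j)(u\<^sub>i)]\<close>. Translating a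
  configuration by one multiplies the summand by \<open>q = \<Prod>(1 + v\<^sub>i) / \<Prod>(1 + u\<^sub>i)\<close>, and \<open>\<bar>q\<bar> < 1\<close>, so the
  sum is a geometric series times the finite sum over configurations with \<open>y\<^sub>0 = 0\<close>. This finite sum
  has to be \<open>(1 - \<zeta>)\<^bsup>N-1\<^esup> (1 - q) det K\<close>, where \<open>\<zeta> = (z'/z)\<^sup>L\<close> and \<open>K(u,v) = (1 + u) / (u - v)\<close>.

  A product of two \<open>N \<times> N\<close> determinants with columns \<open>\<psi>\<^sub>j\<close>, \<open>\<phi>\<^sub>j\<close> is the mixed discriminant of the rank-one
  kernels \<open>g\<^sub>j = \<psi>\<^sub>j \<otimes> \<phi>\<^sub>j\<close>, while \<open>N! det K\<close> is the mixed discriminant of \<open>N\<close> copies of \<open>K\<close>. The mixed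
  discriminant is symmetric and multilinear, and it vanishes when two of its entries are of rank
  one with a common left or right factor. Its entries can therefore be handled as elements of a commutative
  algebra in which such products are zero.

  The kernels \<open>k\<^sub>j(y) = (\<psi>\<^sub>j(y) \<otimes> \<phi>\<^sub>j(y)) K\<close> (pointwise product with \<open>K\<close>) satisfy
  \<open>k\<^sub>j(y) - k\<^sub>j(y+1) = g\<^sub>j(y)\<close>. As \<open>g\<^sub>j(y)\<close> squares to zero, \<open>g\<^sub>j(y) (k\<^sub>j(y) - C)\<^sup>n / n!\<close>
  telescopes in \<open>y\<close>: it is the difference of \<open>(k\<^sub>j - C)\<^bsup>n+1\<^esup> / (n+1)!\<close> at \<open>y\<close> and at \<open>y + 1\<close>. In the presence
  of \<open>g\<^sub>j(y)\<close>, moreover, the power of \<open>k\<^sub>j(y) - C\<close> is the average, with weights \<open>1 - p\<close> and \<open>p\<close>, of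
  the powers of \<open>k\<^sub>j\<^sub>+\<^sub>1(y+1) - C\<close> and \<open>k\<^sub>j\<^sub>+\<^sub>1(y+2) - C\<close> (\<open>mixpow_cauchy_link\<close>); this is what
  the factors \<open>1 - p\<close> for adjacent particles produce. Summing out the positions
  \<open>y\<^sub>N\<^sub>-\<^sub>1, \<dots>, y\<^sub>1\<close> in this order, one sum after another telescopes, with \<open>C = k\<^sub>N(L)\<close>
  (\<open>tail_eq_mixpow\<close>); the boundary terms come from configurations packed against \<open>L\<close> and
  cancel. There remains \<open>g\<^sub>0(0) (k\<^sub>0(0) - C)\<^bsup>N-1\<^esup> / (N-1)!\<close>.

  The Bethe equations give \<open>C = \<zeta> k\<^sub>0(0) = \<zeta> K\<close>. The remainder is thus
  \<open>(1 - \<zeta>)\<^bsup>N-1\<^esup> g\<^sub>0(0) k\<^sub>0(0)\<^bsup>N-1\<^esup> / (N-1)!\<close>, and a last telescoping turns it into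
  \<open>(1 - \<zeta>)\<^bsup>N-1\<^esup> (det k\<^sub>0(0) - det k\<^sub>0(1))\<close>, where \<open>k\<^sub>0(1) = (1 + v) / (u - v)\<close> and
  \<open>det k\<^sub>0(1) = q det K\<close>.
\<close>

section \<open>Mixed discriminants\<close>

type_synonym kernel = "nat \<Rightarrow> nat \<Rightarrow> complex"

text \<open>The size of the determinants is the number of kernels, so that every list has a mixed
  discriminant and kernels can be moved between lists without tracking a dimension.\<close>

definition mixdisc :: "kernel list \<Rightarrow> complex" where
  "mixdisc xs = (\<Sum>\<sigma> | \<sigma> permutes {..<length xs}. \<Sum>\<tau> | \<tau> permutes {..<length xs}.
     of_int (sign \<sigma> * sign \<tau>) * (\<Prod>i<length xs. (xs ! i) (\<sigma> i) (\<tau> i)))"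

definition rank1 :: "(nat \<Rightarrow> complex) \<Rightarrow> (nat \<Rightarrow> complex) \<Rightarrow> kernel" where
  "rank1 a b = (\<lambda>i j. a i * b j)"

lemma sign_comp_permutes:
  assumes "finite S" "\<sigma> permutes S" "\<pi> permutes S"
  shows "sign (\<sigma> \<circ> \<pi>) = sign \<sigma> * sign \<pi>"
  using assms by (intro sign_compose) (auto intro: permutes_imp_permutation)

text \<open>Reordering the list by \<open>\<pi>\<close> changes both permutations by \<open>\<pi>\<close>, and the two signs of \<open>\<pi>\<close>
  cancel. This is the commutativity on which all later rearrangements of lists rest.\<close>

lemma mixdisc_mset:
  assumes "mset xs = mset ys"
  shows "mixdisc xs = mixdisc ys"
proof -
  obtain \<pi> where \<pi>: "\<pi> permutes {..<length ys}" "permute_list \<pi> ys = xs"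
    using mset_eq_permutation[OF assms] .
  define n where "n = length ys"
  have len: "length xs = n" using assms mset_eq_length n_def by blast
  have \<pi>n: "\<pi> permutes {..<n}" using \<pi> n_def by simp
  let ?P = "{\<sigma>. \<sigma> permutes {..<n}}"
  let ?T = "\<lambda>\<sigma> \<tau>. of_int (sign \<sigma> * sign \<tau>) * (\<Prod>i<n. (xs ! i) (\<sigma> i) (\<tau> i))"
  have "mixdisc xs = (\<Sum>\<sigma>\<in>?P. \<Sum>\<tau>\<in>?P. ?T \<sigma> \<tau>)"
    by (simp add: mixdisc_def len)
  also have "\<dots> = (\<Sum>\<sigma>\<in>?P. \<Sum>\<tau>\<in>?P. ?T (\<sigma> \<circ> \<pi>) (\<tau> \<circ> \<pi>))"
    by (subst sum_permutations_compose_right[OF \<pi>n], rule sum.cong[OF refl],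
        subst sum_permutations_compose_right[OF \<pi>n], rule refl)
  also have "\<dots> = (\<Sum>\<sigma>\<in>?P. \<Sum>\<tau>\<in>?P. of_int (sign \<sigma> * sign \<tau>) * (\<Prod>i<n. (ys ! i) (\<sigma> i) (\<tau> i)))"
  proof (intro sum.cong refl)
    fix \<sigma> \<tau> assume st: "\<sigma> \<in> ?P" "\<tau> \<in> ?P"
    have "sign (\<sigma> \<circ> \<pi>) * sign (\<tau> \<circ> \<pi>) = sign \<sigma> * sign \<tau> * (sign \<pi> * sign \<pi>)"
      using st \<pi>n by (simp add: sign_comp_permutes[where S = "{..<n}"])
    then have sg: "sign (\<sigma> \<circ> \<pi>) * sign (\<tau> \<circ> \<pi>) = sign \<sigma> * sign \<tau>"
      by (simp add: sign_idempotent)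
    have "(\<Prod>i<n. (xs ! i) ((\<sigma> \<circ> \<pi>) i) ((\<tau> \<circ> \<pi>) i))
        = (\<Prod>i<n. (ys ! \<pi> i) (\<sigma> (\<pi> i)) (\<tau> (\<pi> i)))"
      using \<pi> n_def permute_list_nth[of \<pi> ys] by (intro prod.cong) auto
    also have "\<dots> = (\<Prod>i<n. (ys ! i) (\<sigma> i) (\<tau> i))"
      using prod.permute[OF \<pi>n, of "\<lambda>i. (ys ! i) (\<sigma> i) (\<tau> i)"] by (simp add: comp_def)
    finally show "?T (\<sigma> \<circ> \<pi>) (\<tau> \<circ> \<pi>)
        = of_int (sign \<sigma> * sign \<tau>) * (\<Prod>i<n. (ys ! i) (\<sigma> i) (\<tau> i))"
      by (simp only: sg)
  qed
  also have "\<dots> = mixdisc ys" by (simp add: mixdisc_def n_def)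
  finally show ?thesis .
qed

lemma mixdisc_Cons:
  "mixdisc (A # xs) =
    (\<Sum>\<sigma> | \<sigma> permutes {..<Suc (length xs)}. \<Sum>\<tau> | \<tau> permutes {..<Suc (length xs)}.
       A (\<sigma> 0) (\<tau> 0) * (of_int (sign \<sigma> * sign \<tau>) * (\<Prod>i<length xs. (xs ! i) (\<sigma> (Suc i)) (\<tau> (Suc i)))))"
  by (simp add: mixdisc_def prod.lessThan_Suc_shift ac_simps del: prod.lessThan_Suc)

lemma mixdisc_add: "mixdisc ((A + B) # xs) = mixdisc (A # xs) + mixdisc (B # xs)"
  unfolding mixdisc_Cons by (simp add: distrib_right sum.distrib)

lemma mixdisc_scale: "mixdisc ((\<lambda>i j. c * A i j) # xs) = c * mixdisc (A # xs)"
  unfolding mixdisc_Cons by (simp add: sum_distrib_left mult.assoc)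

lemma transpose_01_permutes: "Transposition.transpose 0 1 permutes {..<Suc (Suc n)}"
  by (rule permutes_swap_id) auto

text \<open>The sum over \<open>\<sigma>\<close> is antisymmetric in the row indices of the first two kernels, whereas the
  product depends on these indices only through \<open>a (\<sigma> 0) * a (\<sigma> 1)\<close>.\<close>

lemma mixdisc_same_left: "mixdisc (rank1 a b # rank1 a c # xs) = 0"
proof -
  define n where "n = Suc (Suc (length xs))"
  define X where "X = rank1 a b # rank1 a c # xs"
  define t :: "nat \<Rightarrow> nat" where "t = Transposition.transpose 0 1"
  let ?P = "{\<sigma>. \<sigma> permutes {..<n}}"
  define T where "T \<sigma> \<tau> = complex_of_int (sign \<sigma> * sign \<tau>) * (\<Prod>i<n. (X ! i) (\<sigma> i) (\<tau> i))" for \<sigma> \<tau>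
  have t: "t permutes {..<n}" unfolding t_def n_def by (rule transpose_01_permutes)
  have flip: "T (\<sigma> \<circ> t) \<tau> = - T \<sigma> \<tau>" if "\<sigma> \<in> ?P" for \<sigma> \<tau>
  proof -
    have "sign (\<sigma> \<circ> t) = - sign \<sigma>"
      using that t by (simp add: sign_comp_permutes[where S = "{..<n}"]) (simp add: t_def sign_swap_id)
    moreover have "(\<Prod>i<n. (X ! i) ((\<sigma> \<circ> t) i) (\<tau> i)) = (\<Prod>i<n. (X ! i) (\<sigma> i) (\<tau> i))"
      unfolding n_def X_def
      by (simp add: prod.lessThan_Suc_shift t_def rank1_def transpose_def del: prod.lessThan_Suc)
    ultimately show ?thesis unfolding T_def by simp
  qed
  have "mixdisc X = (\<Sum>\<sigma>\<in>?P. \<Sum>\<tau>\<in>?P. T \<sigma> \<tau>)"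
    by (simp add: mixdisc_def T_def n_def X_def)
  also have "\<dots> = (\<Sum>\<sigma>\<in>?P. \<Sum>\<tau>\<in>?P. T (\<sigma> \<circ> t) \<tau>)"
    by (rule sum_permutations_compose_right[OF t])
  also have "\<dots> = - (\<Sum>\<sigma>\<in>?P. \<Sum>\<tau>\<in>?P. T \<sigma> \<tau>)"
    by (simp add: flip sum_negf)
  also have "(\<Sum>\<sigma>\<in>?P. \<Sum>\<tau>\<in>?P. T \<sigma> \<tau>) = mixdisc X"
    by (simp add: mixdisc_def T_def n_def X_def)
  finally show ?thesis by (simp add: X_def)
qed

lemma mixdisc_swap_arguments: "mixdisc (map (\<lambda>A i j. A j i) xs) = mixdisc xs"
  unfolding mixdisc_def
  by (subst sum.swap) (simp add: mult.commute)

lemma mixdisc_same_right: "mixdisc (rank1 b a # rank1 c a # xs) = 0"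
proof -
  have "mixdisc (map (\<lambda>A i j. A j i) (rank1 b a # rank1 c a # xs))
      = mixdisc (rank1 a b # rank1 a c # map (\<lambda>A i j. A j i) xs)"
    by (simp add: rank1_def mult.commute)
  then show ?thesis by (simp only: mixdisc_same_left mixdisc_swap_arguments)
qed

lemma det_row_expansion:
  "det (mat n n (\<lambda>(i, j). A i j)) =
     (\<Sum>\<tau> | \<tau> permutes {..<n}. of_int (sign \<tau>) * (\<Prod>i<n. (A i (\<tau> i) :: complex)))"
  by (subst det_def'[of _ n])
    (auto simp: atLeast0LessThan intro!: sum.cong prod.cong dest: permutes_in_image)

lemma det_col_expansion:
  "det (mat n n (\<lambda>(i, j). A i j)) =
     (\<Sum>\<tau> | \<tau> permutes {..<n}. of_int (sign \<tau>) * (\<Prod>j<n. (A (\<tau> j) j :: complex)))"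
  by (subst det_col[of _ n])
    (auto simp: atLeast0LessThan intro!: sum.cong prod.cong dest: permutes_in_image)

lemma mixdisc_replicate_det:
  "mixdisc (replicate n A) = fact n * det (mat n n (\<lambda>(i, j). A i j))"
proof -
  let ?P = "{\<sigma>. \<sigma> permutes {..<n}}"
  let ?D = "det (mat n n (\<lambda>(i, j). A i j))"
  note D = det_row_expansion[of n A]
  have "(\<Sum>\<tau>\<in>?P. of_int (sign \<sigma> * sign \<tau>) * (\<Prod>i<n. A (\<sigma> i) (\<tau> i))) = ?D"
    if \<sigma>: "\<sigma> permutes {..<n}" for \<sigma>
  proof -
    have "(\<Sum>\<tau>\<in>?P. of_int (sign \<sigma> * sign \<tau>) * (\<Prod>i<n. A (\<sigma> i) (\<tau> i)))
        = (\<Sum>\<tau>\<in>?P. of_int (sign \<sigma> * sign (\<tau> \<circ> \<sigma>)) * (\<Prod>i<n. A (\<sigma> i) ((\<tau> \<circ> \<sigma>) i)))"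
      by (rule sum_permutations_compose_right[OF \<sigma>])
    also have "\<dots> = (\<Sum>\<tau>\<in>?P. of_int (sign \<tau>) * (\<Prod>i<n. A i (\<tau> i)))"
    proof (rule sum.cong[OF refl])
      fix \<tau> assume "\<tau> \<in> ?P"
      then have "sign \<sigma> * sign (\<tau> \<circ> \<sigma>) = sign \<tau> * (sign \<sigma> * sign \<sigma>)"
        using \<sigma> by (simp add: sign_comp_permutes[where S = "{..<n}"])
      moreover have "(\<Prod>i<n. A (\<sigma> i) ((\<tau> \<circ> \<sigma>) i)) = (\<Prod>i<n. A i (\<tau> i))"
        using prod.permute[OF \<sigma>, of "\<lambda>i. A i (\<tau> i)"] by (simp add: comp_def)
      ultimately show "of_int (sign \<sigma> * sign (\<tau> \<circ> \<sigma>)) * (\<Prod>i<n. A (\<sigma> i) ((\<tau> \<circ> \<sigma>) i))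
          = of_int (sign \<tau>) * (\<Prod>i<n. A i (\<tau> i))"
        by (simp add: sign_idempotent)
    qed
    finally show ?thesis using D by simp
  qed
  then have "mixdisc (replicate n A) = (\<Sum>\<sigma>\<in>?P. ?D)"
    by (simp add: mixdisc_def)
  also have "\<dots> = fact n * ?D"
    by (simp add: card_permutations[OF refl])
  finally show ?thesis .
qed

lemma mixdisc_rank1_det:
  "mixdisc (map (\<lambda>j. rank1 (a j) (b j)) [0..<n])
     = det (mat n n (\<lambda>(i, j). a j i)) * det (mat n n (\<lambda>(i, j). b j i))"
  unfolding det_col_expansion sum_product mixdisc_def
  by (auto intro!: sum.cong simp: rank1_def prod.distrib)

lemma det_scale_rows:
  "det (mat n n (\<lambda>(i, j). c i * A i j)) = (\<Prod>i<n. c i) * det (mat n n (\<lambda>(i, j). (A i j :: complex)))"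
  unfolding det_row_expansion by (simp add: prod.distrib sum_distrib_left mult.left_commute)

lemma det_scale_cols:
  "det (mat n n (\<lambda>(i, j). c j * A i j)) = (\<Prod>j<n. c j) * det (mat n n (\<lambda>(i, j). (A i j :: complex)))"
  unfolding det_col_expansion by (simp add: prod.distrib sum_distrib_left mult.left_commute)

section \<open>Divided powers of a kernel\<close>

text \<open>The divided power \<open>X\<^sup>n / n!\<close> multiplied by the elements of \<open>gs\<close>. Dividing by \<open>n!\<close> makes
  the binomial expansion with a square-zero summand free of coefficients, and it makes
  \<open>mixpow [] n X\<close> the determinant of \<open>X\<close>.\<close>

definition mixpow :: "kernel list \<Rightarrow> nat \<Rightarrow> kernel \<Rightarrow> complex" where
  "mixpow gs n X = mixdisc (gs @ replicate n X) / fact n"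

lemma mixdisc_replicate_add:
  assumes "\<And>xs. mixdisc (S # S # xs) = 0"
  shows "mixdisc (gs @ replicate n (X + S))
    = mixdisc (gs @ replicate n X) + of_nat n * mixdisc (S # gs @ replicate (n - 1) X)"
proof (induction n arbitrary: gs)
  case (Suc n)
  have "mixdisc (gs @ replicate (Suc n) (X + S)) = mixdisc ((X + S) # gs @ replicate n (X + S))"
    by (rule mixdisc_mset) simp
  also have "\<dots> = mixdisc ((X # gs) @ replicate n (X + S)) + mixdisc ((S # gs) @ replicate n (X + S))"
    by (simp add: mixdisc_add)
  also have "\<dots> = mixdisc ((X # gs) @ replicate n X)
      + of_nat n * mixdisc (S # X # gs @ replicate (n - 1) X) + mixdisc (S # gs @ replicate n X)"
    unfolding Suc.IH by (simp add: assms)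
  also have "mixdisc ((X # gs) @ replicate n X) = mixdisc (gs @ replicate (Suc n) X)"
    by (rule mixdisc_mset) simp
  also have "of_nat n * mixdisc (S # X # gs @ replicate (n - 1) X)
      = of_nat n * mixdisc (S # gs @ replicate n X)"
    by (cases n) (auto intro: mixdisc_mset)
  finally show ?case by (simp add: algebra_simps)
qed simp

lemma mixpow_add:
  assumes "\<And>xs. mixdisc (S # S # xs) = 0"
  shows "mixpow gs (Suc n) (X + S) = mixpow gs (Suc n) X + mixpow (S # gs) n X"
  unfolding mixpow_def mixdisc_replicate_add[OF assms]
  by (simp add: add_divide_distrib del: replicate.simps of_nat_Suc)

text \<open>A summand that is annihilated by the factors already present may be dropped.\<close>

lemma mixpow_add_absorb:
  assumes "\<And>xs. mixdisc (S # gs @ xs) = 0"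
  shows "mixpow gs n (X + S) = mixpow gs n X"
proof -
  have "mixdisc (hs @ gs @ replicate n (X + S)) = mixdisc (hs @ gs @ replicate n X)" for hs
  proof (induction n arbitrary: hs)
    case (Suc n)
    have "mixdisc (hs @ gs @ replicate (Suc n) (X + S))
        = mixdisc ((X + S) # hs @ gs @ replicate n (X + S))"
      by (rule mixdisc_mset) simp
    also have "\<dots> = mixdisc ((X # hs) @ gs @ replicate n (X + S))
        + mixdisc (S # hs @ gs @ replicate n (X + S))"
      by (simp add: mixdisc_add)
    also have "mixdisc (S # hs @ gs @ replicate n (X + S))
        = mixdisc (S # gs @ hs @ replicate n (X + S))"
      by (rule mixdisc_mset) simp
    also have "\<dots> = 0" by (rule assms)
    also have "mixdisc ((X # hs) @ gs @ replicate n (X + S)) = mixdisc ((X # hs) @ gs @ replicate n X)"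
      by (rule Suc.IH)
    also have "\<dots> = mixdisc (hs @ gs @ replicate (Suc n) X)"
      by (rule mixdisc_mset) simp
    finally show ?case by simp
  qed simp
  from this[of "[]"] show ?thesis by (simp add: mixpow_def)
qed

lemma mixpow_scale: "mixpow gs n (\<lambda>i j. c * X i j) = c ^ n * mixpow gs n X"
proof -
  have "mixdisc (gs @ replicate n (\<lambda>i j. c * X i j)) = c ^ n * mixdisc (gs @ replicate n X)"
  proof (induction n arbitrary: gs)
    case (Suc n)
    have "mixdisc (gs @ replicate (Suc n) (\<lambda>i j. c * X i j))
        = mixdisc ((\<lambda>i j. c * X i j) # gs @ replicate n (\<lambda>i j. c * X i j))"
      by (rule mixdisc_mset) simp
    also have "\<dots> = c * mixdisc ((X # gs) @ replicate n (\<lambda>i j. c * X i j))"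
      by (simp add: mixdisc_scale)
    also have "\<dots> = c * (c ^ n * mixdisc ((X # gs) @ replicate n X))"
      by (simp only: Suc.IH)
    also have "mixdisc ((X # gs) @ replicate n X) = mixdisc (gs @ replicate (Suc n) X)"
      by (rule mixdisc_mset) simp
    finally show ?case by simp
  qed simp
  then show ?thesis by (simp add: mixpow_def)
qed

section \<open>One-particle functions and the Cauchy kernel\<close>

definition mode :: "complex \<Rightarrow> nat \<Rightarrow> int \<Rightarrow> complex \<Rightarrow> complex" where
  "mode p j y w = (w / (1 + p * w)) ^ j * (1 + w) powi (y - int j)"

definition regular :: "complex \<Rightarrow> complex \<Rightarrow> bool" where
  "regular p w \<longleftrightarrow> w \<noteq> 0 \<and> 1 + w \<noteq> 0 \<and> 1 + p * w \<noteq> 0"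

lemma mode_nonzero: "regular p w \<Longrightarrow> mode p j y w \<noteq> 0"
  by (simp add: mode_def regular_def)

lemma mode_add:
  assumes "regular p w"
  shows "mode p j (y + t) w = (1 + w) powi t * mode p j y w"
proof -
  have "(1 + w) powi (y + t - int j) = (1 + w) powi (t + (y - int j))"
    by (rule arg_cong) simp
  also have "\<dots> = (1 + w) powi t * (1 + w) powi (y - int j)"
    using assms by (intro power_int_add) (simp add: regular_def)
  finally show ?thesis by (simp add: mode_def)
qed

lemma mode_up: "regular p w \<Longrightarrow> mode p j (y + 1) w = (1 + w) * mode p j y w"
  by (simp add: mode_add)

lemma mode_diag: "mode p (Suc j) (y + 1) w = w / (1 + p * w) * mode p j y w"
  by (simp add: mode_def)

lemma mode_down: "regular p w \<Longrightarrow> mode p j (y - 1) w = mode p j y w / (1 + w)"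
  using mode_up[of p w j "y - 1"] by (simp add: regular_def field_simps)

lemma mode_Suc:
  "regular p w \<Longrightarrow> mode p (Suc j) y w = w / ((1 + p * w) * (1 + w)) * mode p j y w"
  using mode_diag[of p j "y - 1" w] by (simp add: mode_down)

text \<open>The next two recurrences are where the adjacency weights come from: both say
  \<open>w = (w / (1 + p w)) ((1 - p) + p (1 + w))\<close>, multiplied by a mode and by an inverse mode.\<close>

lemma mode_recurrence:
  assumes "regular p w"
  shows "mode p j (y + 1) w - mode p j y w
    = (1 - p) * mode p (Suc j) (y + 1) w + p * mode p (Suc j) (y + 2) w"
proof -
  have "mode p (Suc j) (y + 2) w = (1 + w) * mode p (Suc j) (y + 1) w"
    using mode_up[OF assms, of "Suc j" "y + 1"] by (simp add: add.assoc)
  then show ?thesis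
    using assms unfolding regular_def
    by (simp add: mode_up[OF assms] mode_diag divide_simps) (simp add: algebra_simps)
qed

lemma inverse_mode_recurrence:
  assumes "regular p w"
  shows "1 / mode p (Suc j) y w - 1 / mode p (Suc j) (y + 1) w
    = (1 - p) * (1 / mode p j y w) + p * (1 / mode p j (y - 1) w)"
  using assms mode_nonzero[OF assms, of j y] unfolding regular_def
  by (simp add: mode_up[OF assms] mode_Suc[OF assms] mode_down[OF assms] divide_simps)
     (simp add: algebra_simps)

text \<open>The arguments of the right and left Bethe functions are \<open>u\<close> and \<open>v\<close>. They are total
  sequences, so that identities between kernels hold as equalities of functions.\<close>

locale mode_pair =
  fixes p :: complex and u v :: "nat \<Rightarrow> complex"
  assumes regular_u: "\<And>i. regular p (u i)"
    and regular_v: "\<And>i. regular p (v i)"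
    and u_neq_v: "\<And>i j. u i \<noteq> v j"
begin

definition psi :: "nat \<Rightarrow> int \<Rightarrow> nat \<Rightarrow> complex" where
  "psi j y i = 1 / mode p j y (u i)"

definition phi :: "nat \<Rightarrow> int \<Rightarrow> nat \<Rightarrow> complex" where
  "phi j y i = mode p j y (v i)"

definition step :: "nat \<Rightarrow> int \<Rightarrow> kernel" where
  "step j y = rank1 (psi j y) (phi j y)"

text \<open>This is the difference \<open>cauchy j y - cauchy (Suc j) (y + 1)\<close> along a diagonal step. A step
  in \<open>j\<close> alone would in general change the kernel by one of rank two.\<close>

definition diag_step :: "nat \<Rightarrow> int \<Rightarrow> kernel" where
  "diag_step j y = rank1 (\<lambda>i. psi (Suc j) y i - p * psi j (y - 1) i)
     (\<lambda>i. phi j y i - p * phi (Suc j) (y + 1) i)"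

definition cauchy :: "nat \<Rightarrow> int \<Rightarrow> kernel" where
  "cauchy j y = (\<lambda>i i'. psi j y i * phi j y i' * ((1 + u i) / (u i - v i')))"

lemma phi_recurrence:
  "phi j (y + 1) i - phi j y i = (1 - p) * phi (Suc j) (y + 1) i + p * phi (Suc j) (y + 2) i"
  unfolding phi_def by (rule mode_recurrence[OF regular_v])

lemma psi_recurrence:
  "psi (Suc j) y i - psi (Suc j) (y + 1) i = (1 - p) * psi j y i + p * psi j (y - 1) i"
  unfolding psi_def by (rule inverse_mode_recurrence[OF regular_u])

lemma cauchy_up: "cauchy j y = cauchy j (y + 1) + step j y"
proof (intro ext)
  fix i i'
  have "1 + u i \<noteq> 0" "u i - v i' \<noteq> 0" using regular_u u_neq_v by (auto simp: regular_def)
  then show "cauchy j y i i' = (cauchy j (y + 1) + step j y) i i'"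
    using mode_nonzero[OF regular_u, of j y i]
    by (simp add: cauchy_def step_def rank1_def psi_def phi_def mode_up[OF regular_u]
        mode_up[OF regular_v] divide_simps) (simp add: algebra_simps)
qed

text \<open>Cancelling the denominator \<open>u - v\<close> in \<open>1 - v (1 + p u) / (u (1 + p v))\<close> leaves a product of a
  function of \<open>u\<close> and a function of \<open>v\<close>, hence a difference of rank one.\<close>

lemma cauchy_diag: "cauchy j y = cauchy (Suc j) (y + 1) + diag_step j y"
proof (intro ext)
  fix i i'
  have nz: "1 + u i \<noteq> 0" "u i - v i' \<noteq> 0" "u i \<noteq> 0" "1 + p * u i \<noteq> 0" "1 + p * v i' \<noteq> 0"
    using regular_u[of i] regular_v[of i'] u_neq_v[of i i'] by (auto simp: regular_def)
  define a b A B where "a = u i" and "b = v i'" and "A = mode p j y a" and "B = mode p j y b"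
  have A: "A \<noteq> 0" using mode_nonzero[OF regular_u] by (simp add: A_def a_def)
  have "1 / A * B * ((1 + a) / (a - b)) = 1 / (a / (1 + p * a) * A) * (b / (1 + p * b) * B) * ((1 + a) / (a - b))
      + (1 / (a / ((1 + p * a) * (1 + a)) * A) - p * (1 / (A / (1 + a)))) * (B - p * (b / (1 + p * b) * B))"
    using nz A unfolding a_def[symmetric] b_def[symmetric]
    by (simp add: divide_simps) (simp add: algebra_simps)
  then show "cauchy j y i i' = (cauchy (Suc j) (y + 1) + diag_step j y) i i'"
    by (simp add: cauchy_def diag_step_def rank1_def psi_def phi_def mode_diag
        mode_Suc[OF regular_u] mode_down[OF regular_u] a_def b_def A_def B_def)
qed

lemma step_square: "mixdisc (step j y # step j y # xs) = 0"
  unfolding step_def by (rule mixdisc_same_left)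

lemma diag_step_square: "mixdisc (diag_step j y # diag_step j y # xs) = 0"
  unfolding diag_step_def by (rule mixdisc_same_left)

text \<open>The recurrence for \<open>psi\<close> rewrites the left factor of the diagonal step as
  \<open>psi (Suc j) (y + 1) + (1 - p) * psi j y\<close>; every term of the resulting expansion but one shares a
  factor with \<open>step j y\<close>.\<close>

lemma diag_step_next:
  "mixdisc (diag_step j y # step j y # xs) = - p * mixdisc (step (Suc j) (y + 1) # step j y # xs)"
proof -
  let ?b = "\<lambda>i. phi j y i - p * phi (Suc j) (y + 1) i"
  have "diag_step j y = (\<lambda>i i'. - p * step (Suc j) (y + 1) i i')
      + (rank1 (psi (Suc j) (y + 1)) (phi j y) + (\<lambda>i i'. (1 - p) * rank1 (psi j y) ?b i i'))"
  proof (intro ext)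
    fix i i'
    have a: "psi (Suc j) y i - p * psi j (y - 1) i = psi (Suc j) (y + 1) i + (1 - p) * psi j y i"
      using psi_recurrence[of j y i] by (simp add: algebra_simps)
    have "diag_step j y i i' = (psi (Suc j) y i - p * psi j (y - 1) i) * ?b i'"
      unfolding diag_step_def rank1_def ..
    also have "\<dots> = (psi (Suc j) (y + 1) i + (1 - p) * psi j y i) * ?b i'"
      by (simp only: a)
    finally show "diag_step j y i i' = ((\<lambda>i i'. - p * step (Suc j) (y + 1) i i')
      + (rank1 (psi (Suc j) (y + 1)) (phi j y) + (\<lambda>i i'. (1 - p) * rank1 (psi j y) ?b i i'))) i i'"
      unfolding rank1_def step_def by (simp add: algebra_simps)
  qed
  then have "mixdisc (diag_step j y # step j y # xs)
      = - p * mixdisc (step (Suc j) (y + 1) # step j y # xs)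
        + mixdisc (rank1 (psi (Suc j) (y + 1)) (phi j y) # step j y # xs)
        + (1 - p) * mixdisc (rank1 (psi j y) ?b # step j y # xs)"
    by (simp only: mixdisc_add mixdisc_scale add.assoc)
  then show ?thesis
    by (simp add: step_def mixdisc_same_left mixdisc_same_right)
qed

text \<open>The mirror image: the recurrence for \<open>phi\<close> rewrites the right factor as
  \<open>phi j (y - 1) + (1 - p) * phi (Suc j) y\<close>, and all but one term share a factor with
  \<open>step (Suc j) y\<close>.\<close>

lemma diag_step_prev:
  "mixdisc (diag_step j y # step (Suc j) y # xs) = - p * mixdisc (step j (y - 1) # step (Suc j) y # xs)"
proof -
  let ?b = "\<lambda>i. phi j y i - p * phi (Suc j) (y + 1) i"
  have "diag_step j y = (\<lambda>i i'. - p * step j (y - 1) i i')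
      + (rank1 (psi (Suc j) y) ?b + (\<lambda>i i'. - p * (1 - p) * rank1 (psi j (y - 1)) (phi (Suc j) y) i i'))"
  proof (intro ext)
    fix i i'
    have b: "?b i' = phi j (y - 1) i' + (1 - p) * phi (Suc j) y i'"
      using phi_recurrence[of j "y - 1" i'] by (simp add: algebra_simps)
    have "diag_step j y i i' = psi (Suc j) y i * ?b i' - p * psi j (y - 1) i * ?b i'"
      unfolding diag_step_def rank1_def by (simp add: left_diff_distrib)
    also have "p * psi j (y - 1) i * ?b i'
        = p * psi j (y - 1) i * (phi j (y - 1) i' + (1 - p) * phi (Suc j) y i')"
      by (simp only: b)
    finally show "diag_step j y i i' = ((\<lambda>i i'. - p * step j (y - 1) i i')
      + (rank1 (psi (Suc j) y) ?b + (\<lambda>i i'. - p * (1 - p) * rank1 (psi j (y - 1)) (phi (Suc j) y) i i'))) i i'"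
      unfolding rank1_def step_def by (simp add: algebra_simps)
  qed
  then have "mixdisc (diag_step j y # step (Suc j) y # xs)
      = - p * mixdisc (step j (y - 1) # step (Suc j) y # xs)
        + mixdisc (rank1 (psi (Suc j) y) ?b # step (Suc j) y # xs)
        + - p * (1 - p) * mixdisc (rank1 (psi j (y - 1)) (phi (Suc j) y) # step (Suc j) y # xs)"
    by (simp only: mixdisc_add mixdisc_scale add.assoc)
  then show ?thesis
    by (simp add: step_def mixdisc_same_left mixdisc_same_right)
qed

text \<open>With \<open>X = cauchy (Suc j) (y + 1) - C\<close>, the left-hand side exceeds the divided power of \<open>X\<close> by
  a multiple of \<open>diag_step j y\<close>, and the right-hand side falls short of it by \<open>p\<close> times a multiple of
  \<open>step (Suc j) (y + 1)\<close>. By \<open>diag_step_next\<close> these corrections agree next to \<open>step j y\<close>.\<close>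

lemma mixpow_cauchy_link:
  "mixpow (step j y # gs) n (cauchy j y - C)
     = (1 - p) * mixpow (step j y # gs) n (cauchy (Suc j) (y + 1) - C)
       + p * mixpow (step j y # gs) n (cauchy (Suc j) (y + 2) - C)"
proof (cases n)
  case 0
  then show ?thesis by (simp add: mixpow_def algebra_simps)
next
  case (Suc m)
  have regroup: "b = (1 - p) * c + p * d" if "b = c + - p * (c - d)" for b c d :: complex
    using that by (simp add: algebra_simps)
  define X where "X = cauchy (Suc j) (y + 1) - C"
  define Y where "Y = cauchy (Suc j) (y + 2) - C"
  have XY: "X = Y + step (Suc j) (y + 1)"
    using cauchy_up[of "Suc j" "y + 1"] by (simp add: X_def Y_def add.assoc)
  have 1: "cauchy j y - C = X + diag_step j y"
    by (simp add: X_def cauchy_diag[of j y])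
  have "mixpow (step j y # gs) n (cauchy j y - C)
      = mixpow (step j y # gs) n X + mixpow (diag_step j y # step j y # gs) m X"
    unfolding 1 Suc by (rule mixpow_add) (rule diag_step_square)
  also have "mixpow (diag_step j y # step j y # gs) m X
      = - p * mixpow (step (Suc j) (y + 1) # step j y # gs) m X"
    by (simp add: mixpow_def diag_step_next)
  also have "mixpow (step (Suc j) (y + 1) # step j y # gs) m X
      = mixpow (step (Suc j) (y + 1) # step j y # gs) m Y"
    unfolding XY by (rule mixpow_add_absorb) (simp add: step_square)
  also have "\<dots> = mixpow (step j y # gs) n X - mixpow (step j y # gs) n Y"
    unfolding XY Suc by (subst mixpow_add) (simp_all add: step_square)
  finally have "mixpow (step j y # gs) n (cauchy j y - C)
      = (1 - p) * mixpow (step j y # gs) n X + p * mixpow (step j y # gs) n Y"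
    by (rule regroup)
  then show ?thesis by (simp only: X_def Y_def)
qed

text \<open>The telescoping identity, with the kernel at \<open>y\<close> and not at \<open>y + 1\<close> in the last term: the two
  differ by \<open>step j y\<close>, which annihilates itself.\<close>

lemma mixpow_cauchy_up:
  "mixpow gs (Suc n) (cauchy j y - C) = mixpow gs (Suc n) (cauchy j (y + 1) - C)
     + mixpow (step j y # gs) n (cauchy j y - C)"
proof -
  have e: "cauchy j y - C = (cauchy j (y + 1) - C) + step j y"
    using cauchy_up[of j y] by simp
  have "mixpow (step j y # gs) n (cauchy j y - C) = mixpow (step j y # gs) n (cauchy j (y + 1) - C)"
    unfolding e by (rule mixpow_add_absorb) (simp add: step_square)
  moreover have "mixpow gs (Suc n) (cauchy j y - C) = mixpow gs (Suc n) (cauchy j (y + 1) - C)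
    + mixpow (step j y # gs) n (cauchy j (y + 1) - C)"
    unfolding e by (rule mixpow_add) (rule step_square)
  ultimately show ?thesis by simp
qed

end

section \<open>Summing out the particles\<close>

text \<open>The Bethe equations say that \<open>mode p N L\<close> is constant on each of the two families, with
  values \<open>z\<^sup>L\<close> and \<open>z'\<^sup>L\<close>.\<close>

locale periodic_mode_pair = mode_pair +
  fixes N :: nat and L :: int and Z Z' :: complex
  assumes N_pos: "1 \<le> N" and N_less_L: "int N < L"
    and Z_nonzero: "Z \<noteq> 0" "Z' \<noteq> 0"
    and period_u: "\<And>i. mode p N L (u i) = Z"
    and period_v: "\<And>i. mode p N L (v i) = Z'"
begin

lemma step_period: "step N L = (\<lambda>i i'. Z' / Z * step 0 0 i i')"
  by (simp add: fun_eq_iff step_def rank1_def psi_def phi_def period_u period_v) (simp add: mode_def)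

lemma cauchy_period: "cauchy N L = (\<lambda>i i'. Z' / Z * cauchy 0 0 i i')"
  by (simp add: fun_eq_iff cauchy_def psi_def phi_def period_u period_v) (simp add: mode_def)

text \<open>The sum over the positions of the last \<open>n\<close> particles, all lying in \<open>{a..<L}\<close>, with the kernels
  of the earlier particles collected in \<open>gs\<close>. The weight of a gap is spread over two lower
  bounds: a sum from \<open>y + 1\<close> with weight \<open>1 - p\<close> plus a sum from \<open>y + 2\<close> with weight \<open>p\<close> counts the
  position \<open>y + 1\<close> with weight \<open>1 - p\<close> and all later ones with weight \<open>1\<close>. The case \<open>n = 0\<close> does the
  same for the gap between the last particle and the image at \<open>L\<close> of the first one.\<close>

primrec tail :: "nat \<Rightarrow> kernel list \<Rightarrow> int \<Rightarrow> complex" where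
  "tail 0 gs a = (if a \<le> L then mixdisc gs else 0)"
| "tail (Suc n) gs a = (\<Sum>y\<in>{a..<L}.
     (1 - p) * tail n (step (N - Suc n) y # gs) (y + 1)
       + p * tail n (step (N - Suc n) y # gs) (y + 2))"

lemma tail_infeasible: "a > L - int n \<Longrightarrow> tail n gs a = 0"
  by (induction n arbitrary: gs a) auto

text \<open>The last \<open>n\<close> particles pushed against \<open>L\<close>, without holes.\<close>

primrec packed :: "nat \<Rightarrow> kernel list" where
  "packed 0 = []"
| "packed (Suc n) = step (N - Suc n) (L - int (Suc n)) # packed n"

text \<open>The \<open>n\<close>-th divided power of this kernel is the telescoped expression for \<open>n\<close> particles at
  \<open>L - n + 1\<close>, the first lower bound for which they no longer fit below \<open>L\<close>. The sum over their
  positions is zero there, but the divided power in general is not: \<open>mixpow_excess\<close> computes it.\<close>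

definition excess :: "nat \<Rightarrow> kernel" where
  "excess n = cauchy (N - n) (L - int n + 1) - cauchy N L"

lemma excess_Suc:
  assumes "Suc n \<le> N"
  shows "excess (Suc n) = excess n + diag_step (N - Suc n) (L - int n)"
proof -
  have "Suc (N - Suc n) = N - n" using assms by simp
  then show ?thesis
    using cauchy_diag[of "N - Suc n" "L - int n"] by (simp add: excess_def)
qed

lemma step_in_absorb:
  assumes "step j y \<in> set gs"
  shows "mixdisc (step j y # gs @ xs) = 0"
proof -
  obtain as bs where gs: "gs = as @ step j y # bs" using assms by (auto simp: in_set_conv_decomp)
  have "mixdisc (step j y # gs @ xs) = mixdisc (step j y # step j y # as @ bs @ xs)"
    by (rule mixdisc_mset) (simp add: gs)
  then show ?thesis by (simp add: step_square)
qed

lemma mixpow_excess_0: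
  assumes "step N L \<in> set gs"
  shows "mixpow gs (Suc m) (excess 0) = 0"
proof -
  have "excess 0 = (\<lambda>i i'. - 1 * step N L i i')"
    using cauchy_up[of N L] by (auto simp: excess_def fun_eq_iff)
  then have "mixpow gs (Suc m) (excess 0) = (- 1) ^ Suc m * mixpow gs (Suc m) (step N L)"
    by (simp only: mixpow_scale)
  also have "mixpow gs (Suc m) (step N L) = mixdisc (step N L # gs @ replicate m (step N L)) / fact (Suc m)"
    unfolding mixpow_def by (rule arg_cong[where f = "\<lambda>x. x / _"], rule mixdisc_mset) simp
  finally show ?thesis using step_in_absorb[OF assms] by simp
qed

text \<open>Up to \<open>step N L\<close>, which is annihilated by \<open>gs\<close>, \<open>excess n\<close> is a sum of \<open>n\<close> square-zero
  kernels, and a product of more than \<open>n\<close> of these contains a square.\<close>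

lemma mixpow_excess_vanish:
  assumes "n \<le> N" "step N L \<in> set gs" "n < m"
  shows "mixpow gs m (excess n) = 0"
  using assms
proof (induction n arbitrary: gs m)
  case 0
  then show ?case using mixpow_excess_0 by (cases m) auto
next
  case (Suc n)
  then obtain m' where m: "m = Suc m'" "n < m'" by (cases m) auto
  have "mixpow gs m (excess (Suc n)) = mixpow gs m (excess n)
      + mixpow (diag_step (N - Suc n) (L - int n) # gs) m' (excess n)"
    unfolding excess_Suc[OF Suc.prems(1)] m(1) by (rule mixpow_add) (rule diag_step_square)
  then show ?case using Suc m by simp
qed

text \<open>Only the product of the \<open>n\<close> diagonal steps survives. Each of them stands next to the step of
  the particle to its right, beginning with \<open>step N L\<close> in \<open>gs\<close>, so that \<open>diag_step_prev\<close> converts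
  them one by one into steps of the packed configuration, each at the cost of a factor \<open>- p\<close>.\<close>

lemma mixpow_excess:
  assumes "n \<le> N" "step N L \<in> set gs"
  shows "mixpow gs n (excess n) = (- p) ^ n * mixdisc (gs @ packed n)"
  using assms
proof (induction n arbitrary: gs)
  case 0
  then show ?case by (simp add: mixpow_def)
next
  case (Suc n)
  define s where "s = diag_step (N - Suc n) (L - int n)"
  have N: "Suc (N - Suc n) = N - n" using Suc.prems by simp
  have mem: "step (N - n) (L - int n) \<in> set (gs @ packed n)"
    using Suc.prems by (cases n) auto
  then obtain as bs where split: "gs @ packed n = as @ step (N - n) (L - int n) # bs"
    using split_list[OF mem] by blast
  have "mixpow gs (Suc n) (excess (Suc n)) = mixpow gs (Suc n) (excess n) + mixpow (s # gs) n (excess n)"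
    unfolding excess_Suc[OF Suc.prems(1)] s_def by (rule mixpow_add) (rule diag_step_square)
  also have "mixpow gs (Suc n) (excess n) = 0"
    using Suc.prems by (intro mixpow_excess_vanish) auto
  also have "mixpow (s # gs) n (excess n) = (- p) ^ n * mixdisc ((s # gs) @ packed n)"
    using Suc by (intro Suc.IH) auto
  also have "mixdisc ((s # gs) @ packed n) = mixdisc (s # step (N - n) (L - int n) # as @ bs)"
    by (rule mixdisc_mset) (use arg_cong[OF split, of mset] in simp)
  also have "\<dots> = - p * mixdisc (step (N - Suc n) (L - int n - 1) # step (N - n) (L - int n) # as @ bs)"
    using diag_step_prev[of "N - Suc n" "L - int n"] by (simp only: N s_def)
  also have "mixdisc (step (N - Suc n) (L - int n - 1) # step (N - n) (L - int n) # as @ bs)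
      = mixdisc (step (N - Suc n) (L - int n - 1) # gs @ packed n)"
    by (rule mixdisc_mset) (simp add: split)
  also have "\<dots> = mixdisc (gs @ packed (Suc n))"
    by (rule mixdisc_mset) (simp add: algebra_simps)
  finally show ?case by simp
qed

lemma sum_head: "b < e \<Longrightarrow> (\<Sum>y\<in>{b..<e}. F y) = F b + (\<Sum>y\<in>{b + 1..<e}. F y)"
  for b e :: int and F :: "int \<Rightarrow> complex"
proof -
  assume "b < e"
  then have "{b..<e} = insert b {b + 1..<e}" by auto
  then show ?thesis by simp
qed

text \<open>The telescoping of all sums. For \<open>a\<close> below the packed position of particle \<open>N - Suc n\<close>, both
  sides change by the same amount when \<open>a\<close> decreases, by \<open>mixpow_cauchy_up\<close> and
  \<open>mixpow_cauchy_link\<close>. The recursion starts at the packed position itself, where the two contributions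
  of packed configurations computed in \<open>mixpow_excess\<close>, with coefficients \<open>(- p) ^ Suc n\<close> and
  \<open>p * (- p) ^ n\<close>, cancel.\<close>

lemma tail_eq_mixpow:
  assumes "n \<le> N" "step N L \<in> set gs" "a \<le> L - int n"
  shows "tail n gs a = mixpow gs n (cauchy (N - n) a - cauchy N L)"
  using assms
proof (induction n arbitrary: gs a)
  case 0
  then show ?case by (simp add: mixpow_def)
next
  case (Suc n)
  define j where "j = N - Suc n"
  have j: "N - n = Suc j" using Suc.prems by (simp add: j_def)
  define m where "m = L - int (Suc n)"
  define C where "C = cauchy N L"
  define link where "link y = (1 - p) * tail n (step j y # gs) (y + 1) + p * tail n (step j y # gs) (y + 2)" for y
  have tail: "tail (Suc n) gs b = (\<Sum>y\<in>{b..<L}. link y)" for b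
    by (simp add: link_def j_def)
  have IH: "tail n (step j y # gs) b = mixpow (step j y # gs) n (cauchy (Suc j) b - C)"
    if "b \<le> m + 1" for y b
    unfolding j[symmetric] C_def
    by (rule Suc.IH) (use Suc.prems that in \<open>auto simp: m_def\<close>)
  define E where "E y = mixpow gs (Suc n) (cauchy j y - C)" for y
  have "a \<le> m" using Suc.prems by (simp add: m_def)
  then have "tail (Suc n) gs a = E a"
  proof (induction a rule: int_le_induct)
    case base
    have "tail n (step j y # gs) b = 0" if "b > m + 1" for y b
      using that by (intro tail_infeasible) (simp add: m_def)
    then have z: "link y = 0" if "y > m" for y using that by (simp add: link_def)
    have zero: "tail n (step j m # gs) (m + 2) = 0"
      by (rule tail_infeasible) (simp add: m_def)
    have "tail (Suc n) gs m = link m + (\<Sum>y\<in>{m + 1..<L}. link y)"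
      unfolding tail by (rule sum_head) (simp add: m_def)
    also have "(\<Sum>y\<in>{m + 1..<L}. link y) = 0" by (rule sum.neutral) (auto simp: z)
    also have "link m = (1 - p) * mixpow (step j m # gs) n (cauchy (Suc j) (m + 1) - C)"
      by (simp add: link_def zero IH)
    finally have 1: "tail (Suc n) gs m = (1 - p) * mixpow (step j m # gs) n (cauchy (Suc j) (m + 1) - C)"
      by simp
    have "mixpow gs (Suc n) (cauchy j (m + 1) - C) = (- p) ^ Suc n * mixdisc (gs @ packed (Suc n))"
      using mixpow_excess[OF Suc.prems(1,2)] by (simp only: excess_def j_def m_def C_def)
    also have "mixdisc (gs @ packed (Suc n)) = mixdisc ((step j m # gs) @ packed n)"
      by (rule mixdisc_mset) (simp add: j_def m_def)
    finally have 2: "mixpow gs (Suc n) (cauchy j (m + 1) - C)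
      = (- p) ^ Suc n * mixdisc ((step j m # gs) @ packed n)" .
    have "mixpow (step j m # gs) n (cauchy (Suc j) (m + 2) - C) = mixpow (step j m # gs) n (excess n)"
    proof -
      have "m + 2 = L - int n + 1" by (simp add: m_def)
      then show ?thesis by (simp only: excess_def j C_def)
    qed
    also have "\<dots> = (- p) ^ n * mixdisc ((step j m # gs) @ packed n)"
      using Suc.prems by (intro mixpow_excess) auto
    finally have 3: "mixpow (step j m # gs) n (cauchy (Suc j) (m + 2) - C)
      = (- p) ^ n * mixdisc ((step j m # gs) @ packed n)" .
    show ?case
      unfolding E_def mixpow_cauchy_up[of gs n j m C] mixpow_cauchy_link[of j m gs n C] 1 2 3 by simp
  next
    case (step a)
    have "tail (Suc n) gs (a - 1) = link (a - 1) + tail (Suc n) gs a"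
      unfolding tail using step.hyps sum_head[of "a - 1" L link] by (simp add: m_def)
    also have "link (a - 1) = mixpow (mode_pair.step p u v j (a - 1) # gs) n (cauchy j (a - 1) - C)"
      unfolding mixpow_cauchy_link[of j "a - 1" gs n C] link_def using step.hyps by (simp add: IH)
    also have "\<dots> + tail (Suc n) gs a = E (a - 1)"
      using mixpow_cauchy_up[of gs n j "a - 1" C] step.IH by (simp add: E_def del: tail.simps)
    finally show ?case .
  qed
  then show ?case unfolding E_def j_def C_def .
qed

lemma tail_scale:
  "tail n (hs @ (\<lambda>i i'. c * A i i') # gs) a = c * tail n (hs @ A # gs) a"
proof (induction n arbitrary: hs a)
  case 0
  have "mixdisc (hs @ (\<lambda>i i'. c * A i i') # gs) = mixdisc ((\<lambda>i i'. c * A i i') # hs @ gs)"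
    by (rule mixdisc_mset) simp
  also have "\<dots> = c * mixdisc (A # hs @ gs)" by (rule mixdisc_scale)
  also have "mixdisc (A # hs @ gs) = mixdisc (hs @ A # gs)"
    by (rule mixdisc_mset) simp
  finally show ?case by simp
next
  case (Suc n)
  have "tail n (step j y # hs @ (\<lambda>i i'. c * A i i') # gs) b = c * tail n (step j y # hs @ A # gs) b" for j y b
    using Suc.IH[of "step j y # hs" b] by simp
  then show ?case by (simp add: sum_distrib_left algebra_simps)
qed

text \<open>Periodicity replaces \<open>step N L\<close>, needed in \<open>tail_eq_mixpow\<close>, by the kernel \<open>step 0 0\<close> of the
  first particle, and makes \<open>cauchy 0 0 - cauchy N L\<close> a multiple of \<open>cauchy 0 0\<close>. The
  hypothesis \<open>N < L\<close> ensures that both lower bounds \<open>1\<close> and \<open>2\<close> leave room for \<open>N - 1\<close> particles.\<close>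

lemma tail_total:
  "(1 - p) * tail (N - 1) [step 0 0] 1 + p * tail (N - 1) [step 0 0] 2
     = (1 - Z' / Z) ^ (N - 1) * (mixpow [] N (cauchy 0 0) - mixpow [] N (cauchy 0 1))"
proof -
  define M where "M = N - 1"
  define c where "c = Z' / Z"
  define C where "C = cauchy N L"
  have N: "N = Suc M" using N_pos by (simp add: M_def)
  have c: "c \<noteq> 0" using Z_nonzero by (simp add: c_def)
  have tail: "tail M [step 0 0] a = mixpow [step 0 0] M (cauchy 1 a - C)" if "a \<le> 2" for a
  proof -
    have "c * tail M [step 0 0] a = tail M [step N L] a"
      using tail_scale[of M "[]" c "step 0 0" "[]"] by (simp add: step_period c_def)
    also have "\<dots> = mixpow [step N L] M (cauchy (N - M) a - C)"
      unfolding C_def by (rule tail_eq_mixpow) (use that N N_less_L in auto)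
    also have "\<dots> = c * mixpow [step 0 0] M (cauchy 1 a - C)"
      unfolding step_period mixpow_def using mixdisc_scale[of c "step 0 0"] by (simp add: c_def N)
    finally show ?thesis using c by simp
  qed
  have "(1 - p) * tail M [step 0 0] 1 + p * tail M [step 0 0] 2 = mixpow [step 0 0] M (cauchy 0 0 - C)"
    using mixpow_cauchy_link[of 0 0 "[]" M C] by (simp add: tail)
  also have "cauchy 0 0 - C = (\<lambda>i i'. (1 - c) * cauchy 0 0 i i')"
    unfolding C_def cauchy_period by (auto simp: fun_eq_iff c_def algebra_simps)
  also have "mixpow [step 0 0] M \<dots> = (1 - c) ^ M * mixpow [step 0 0] M (cauchy 0 0)"
    by (rule mixpow_scale)
  also have "mixpow [step 0 0] M (cauchy 0 0) = mixpow [] N (cauchy 0 0) - mixpow [] N (cauchy 0 1)"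
    using mixpow_cauchy_up[of "[]" M 0 0 0] by (simp add: N)
  finally show ?thesis by (simp add: M_def c_def)
qed

end

section \<open>The sum over configurations with the first particle at the origin\<close>

definition inc_lists :: "nat \<Rightarrow> int \<Rightarrow> int \<Rightarrow> int list set" where
  "inc_lists n a b = {ys. length ys = n \<and> sorted_wrt (<) ys \<and> set ys \<subseteq> {a..<b}}"

lemma inc_lists_0: "inc_lists 0 a b = {[]}"
  by (auto simp: inc_lists_def)

lemma inc_lists_Suc: "inc_lists (Suc n) a b = (\<Union>y\<in>{a..<b}. (#) y ` inc_lists n (y + 1) b)"
proof (intro equalityI subsetI)
  fix xs assume "xs \<in> inc_lists (Suc n) a b"
  then obtain y ys where xs: "xs = y # ys" and h: "length ys = n" "sorted_wrt (<) (y # ys)" "set (y # ys) \<subseteq> {a..<b}"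
    by (cases xs) (auto simp: inc_lists_def)
  have "y \<in> {a..<b}" using h by simp
  moreover have "ys \<in> inc_lists n (y + 1) b"
    using h by (fastforce simp: inc_lists_def)
  ultimately show "xs \<in> (\<Union>y\<in>{a..<b}. (#) y ` inc_lists n (y + 1) b)" using xs by blast
qed (fastforce simp: inc_lists_def)

lemma finite_inc_lists: "finite (inc_lists n a b)"
  by (induction n arbitrary: a) (auto simp: inc_lists_0 inc_lists_Suc)

lemma sum_inc_lists_Suc:
  "sum F (inc_lists (Suc n) a b) = (\<Sum>y\<in>{a..<b}. \<Sum>ys\<in>inc_lists n (y + 1) b. F (y # ys))"
  unfolding inc_lists_Suc
  by (subst sum.UNION_disjoint) (auto simp: finite_inc_lists sum.reindex)

text \<open>Appending \<open>L\<close> closes the ring when the list starts at \<open>0\<close>.\<close>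

definition gap_weight :: "complex \<Rightarrow> int \<Rightarrow> int list \<Rightarrow> complex" where
  "gap_weight p L ys = (\<Prod>k<length ys. 1 - p * of_bool ((ys @ [L]) ! Suc k - ys ! k = 1))"

lemma gap_weight_single: "gap_weight p L [y] = 1 - p * of_bool (L - y = 1)"
  by (simp add: gap_weight_def)

lemma gap_weight_Cons:
  "gap_weight p L (y # y' # ys) = (1 - p * of_bool (y' - y = 1)) * gap_weight p L (y' # ys)"
  unfolding gap_weight_def
  by (simp add: prod.lessThan_Suc_shift del: prod.lessThan_Suc)

context periodic_mode_pair
begin

definition steps :: "nat \<Rightarrow> int list \<Rightarrow> kernel list" where
  "steps j ys = map (\<lambda>k. step (j + k) (ys ! k)) [0..<length ys]"

lemma steps_Cons: "steps j (y # ys) = step j y # steps (Suc j) ys"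
  by (simp add: steps_def upt_rec[of 0 "Suc (length ys)"] map_Suc_upt[symmetric] del: upt_Suc)

text \<open>The lower bounds \<open>y + 1\<close> and \<open>y + 2\<close> differ only in the position \<open>y + 1\<close>, so combining them with
  coefficients \<open>1 - p\<close> and \<open>p\<close> puts the adjacency weight on the next particle.\<close>

lemma tail_eq_sum_inc_lists:
  assumes "n \<le> N" "y < L"
  shows "(1 - p) * tail n gs (y + 1) + p * tail n gs (y + 2)
    = (\<Sum>ys\<in>inc_lists n (y + 1) L. gap_weight p L (y # ys) * mixdisc (steps (N - n) ys @ gs))"
  using assms
proof (induction n arbitrary: gs y)
  case 0
  then show ?case by (auto simp: inc_lists_0 gap_weight_single steps_def algebra_simps)
next
  case (Suc n)
  define j where "j = N - Suc n"
  have j: "N - n = Suc j" using Suc.prems by (simp add: j_def)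
  define link where "link y = (1 - p) * tail n (step j y # gs) (y + 1) + p * tail n (step j y # gs) (y + 2)" for y
  have tail: "tail (Suc n) gs b = (\<Sum>y\<in>{b..<L}. link y)" for b
    by (simp add: link_def j_def)
  have split: "(\<Sum>y'\<in>{y + 1..<L}. F y') = (\<Sum>y'\<in>{y + 1..<L}. of_bool (y' - y = 1) * F y')
      + (\<Sum>y'\<in>{y + 2..<L}. F y')" for F :: "int \<Rightarrow> complex"
  proof (cases "y + 1 < L")
    case True
    then have e: "{y + 1..<L} = insert (y + 1) {y + 2..<L}" by auto
    have "{y + 2..<L} \<inter> {y'. y' - y = 1} = {}" by auto
    then show ?thesis unfolding e by simp
  qed simp
  have "(1 - p) * tail (Suc n) gs (y + 1) + p * tail (Suc n) gs (y + 2)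
      = (\<Sum>y'\<in>{y + 1..<L}. link y') - p * (\<Sum>y'\<in>{y + 1..<L}. of_bool (y' - y = 1) * link y')"
    unfolding tail using split[of link] by (simp add: algebra_simps)
  also have "\<dots> = (\<Sum>y'\<in>{y + 1..<L}. (1 - p * of_bool (y' - y = 1)) * link y')"
    by (simp only: sum_distrib_left sum_subtractf left_diff_distrib mult.assoc mult_1_left)
  also have "\<dots> = (\<Sum>y'\<in>{y + 1..<L}. \<Sum>ys\<in>inc_lists n (y' + 1) L.
      gap_weight p L (y # y' # ys) * mixdisc (steps j (y' # ys) @ gs))"
  proof (rule sum.cong[OF refl])
    fix y' assume y': "y' \<in> {y + 1..<L}"
    have "link y' = (\<Sum>ys\<in>inc_lists n (y' + 1) L.
        gap_weight p L (y' # ys) * mixdisc (steps (Suc j) ys @ step j y' # gs))"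
      unfolding link_def j[symmetric] by (rule Suc.IH) (use Suc.prems y' in auto)
    moreover have "mixdisc (steps (Suc j) ys @ step j y' # gs) = mixdisc (steps j (y' # ys) @ gs)" for ys
      by (rule mixdisc_mset) (simp add: steps_Cons)
    ultimately show "(1 - p * of_bool (y' - y = 1)) * link y' = (\<Sum>ys\<in>inc_lists n (y' + 1) L.
        gap_weight p L (y # y' # ys) * mixdisc (steps j (y' # ys) @ gs))"
      by (simp add: gap_weight_Cons sum_distrib_left mult.assoc)
  qed
  also have "\<dots> = (\<Sum>ys\<in>inc_lists (Suc n) (y + 1) L. gap_weight p L (y # ys) * mixdisc (steps j ys @ gs))"
    by (simp add: sum_inc_lists_Suc)
  finally show ?case by (simp add: j_def)
qed

definition det_psi :: "int list \<Rightarrow> complex" where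
  "det_psi ys = det (mat N N (\<lambda>(i, j). psi j (ys ! j) i))"

definition det_phi :: "int list \<Rightarrow> complex" where
  "det_phi ys = det (mat N N (\<lambda>(i, j). phi j (ys ! j) i))"

lemma sum_inc_lists:
  "(\<Sum>ys\<in>inc_lists (N - 1) 1 L. gap_weight p L (0 # ys) * (det_psi (0 # ys) * det_phi (0 # ys)))
     = (1 - Z' / Z) ^ (N - 1) * ((\<Prod>i<N. 1 + u i) - (\<Prod>i<N. 1 + v i))
         * det (mat N N (\<lambda>(i, j). 1 / (u i - v j)))"
proof -
  have "mixdisc (steps 1 ys @ [step 0 0]) = det_psi (0 # ys) * det_phi (0 # ys)"
    if "ys \<in> inc_lists (N - 1) 1 L" for ys
  proof -
    have len: "length (0 # ys) = N" using that N_pos by (auto simp: inc_lists_def)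
    have "mixdisc (steps 1 ys @ [step 0 0]) = mixdisc (steps 0 (0 # ys))"
      by (rule mixdisc_mset) (simp add: steps_Cons)
    also have "steps 0 (0 # ys) = map (\<lambda>j. rank1 (psi j ((0 # ys) ! j)) (phi j ((0 # ys) ! j))) [0..<N]"
      unfolding steps_def len by (simp add: step_def)
    finally show ?thesis by (simp only: mixdisc_rank1_det det_psi_def det_phi_def)
  qed
  then have "(\<Sum>ys\<in>inc_lists (N - 1) 1 L. gap_weight p L (0 # ys) * (det_psi (0 # ys) * det_phi (0 # ys)))
      = (1 - p) * tail (N - 1) [step 0 0] 1 + p * tail (N - 1) [step 0 0] 2"
    using tail_eq_sum_inc_lists[of "N - 1" 0 "[step 0 0]"] N_pos N_less_L by simp
  also have "\<dots> = (1 - Z' / Z) ^ (N - 1) * (mixpow [] N (cauchy 0 0) - mixpow [] N (cauchy 0 1))"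
    by (rule tail_total)
  also have "mixpow [] N (cauchy 0 0) = (\<Prod>i<N. 1 + u i) * det (mat N N (\<lambda>(i, j). 1 / (u i - v j)))"
    using det_scale_rows[of N "\<lambda>i. 1 + u i" "\<lambda>i j. 1 / (u i - v j)"]
    by (simp add: mixpow_def mixdisc_replicate_det cauchy_def psi_def phi_def mode_def)
  also have "cauchy 0 1 = (\<lambda>i j. (1 + v j) * (1 / (u i - v j)))"
    using regular_u by (auto simp: fun_eq_iff cauchy_def psi_def phi_def mode_def regular_def)
  also have "mixpow [] N \<dots> = (\<Prod>i<N. 1 + v i) * det (mat N N (\<lambda>(i, j). 1 / (u i - v j)))"
    using det_scale_cols[of N "\<lambda>j. 1 + v j" "\<lambda>i j. 1 / (u i - v j)"]
    by (simp add: mixpow_def mixdisc_replicate_det)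
  finally show ?thesis by (simp add: algebra_simps)
qed

end

section \<open>Configurations as translated increasing lists\<close>

definition config_of :: "nat \<Rightarrow> int \<Rightarrow> int list \<Rightarrow> nat \<Rightarrow> int" where
  "config_of N t ys = (\<lambda>i\<in>{1..N}. t + (0 # ys) ! (N - i))"

lemma config_of_nth: "k < N \<Longrightarrow> config_of N t ys (N - k) = t + (0 # ys) ! k"
  by (auto simp: config_of_def)

lemma config_of_mem:
  assumes "1 \<le> N" "N < L" "ys \<in> inc_lists (N - 1) 1 (int L)"
  shows "config_of N t ys \<in> configs N L"
proof -
  have len: "length (0 # ys) = N" using assms by (auto simp: inc_lists_def)
  have sorted: "sorted_wrt (<) (0 # ys)" using assms by (auto simp: inc_lists_def)
  have less: "y < int L" if "y \<in> set (0 # ys)" for y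
    using that assms by (auto simp: inc_lists_def)
  have "config_of N t ys i > config_of N t ys (Suc i)" if "i \<in> {1..<N}" for i
  proof -
    have "(0 # ys) ! (N - Suc i) < (0 # ys) ! (N - i)"
      using that len by (intro sorted_wrt_nth_less[OF sorted]) auto
    then show ?thesis using that by (simp add: config_of_def)
  qed
  moreover have "config_of N t ys 1 < config_of N t ys N + int L"
  proof -
    have "(0 # ys) ! (N - 1) \<in> set (0 # ys)" using len assms(1) by (intro nth_mem) auto
    then show ?thesis using less assms(1) by (simp add: config_of_def)
  qed
  ultimately show ?thesis by (auto simp: configs_def config_of_def)
qed

lemma config_of_surj:
  assumes "1 \<le> N" "x \<in> configs N L"
  obtains ys where "ys \<in> inc_lists (N - 1) 1 (int L)" "x = config_of N (x N) ys"
proof -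
  have anti: "x k < x i" if "1 \<le> i" "i < k" "k \<le> N" for i k
    using that(2,3)
  proof (induction k)
    case (Suc k)
    have step: "x (Suc k) < x k" if "1 \<le> k" using that assms Suc.prems by (auto simp: configs_def)
    show ?case
    proof (cases "i = k")
      case False
      then show ?thesis using Suc step \<open>1 \<le> i\<close> by fastforce
    qed (use step \<open>1 \<le> i\<close> in auto)
  qed simp
  define ys where "ys = map (\<lambda>k. x (N - Suc k) - x N) [0..<N - 1]"
  have nth: "(0 # ys) ! k = x (N - k) - x N" if "k < N" for k
    using that by (cases k) (auto simp: ys_def)
  have first: "x 1 < x N + int L" using assms by (simp add: configs_def)
  have "ys \<in> inc_lists (N - 1) 1 (int L)"
  proof -
    have "sorted_wrt (<) ys"
      unfolding ys_def sorted_wrt_map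
      by (rule sorted_wrt_mono_rel[OF _ sorted_wrt_upt]) (auto intro!: anti)
    moreover have "x N < x (N - Suc k)" "x (N - Suc k) < x N + int L" if "k < N - 1" for k
    proof -
      show "x N < x (N - Suc k)" using that by (intro anti) auto
      have "x (N - Suc k) \<le> x 1"
      proof (cases "N - Suc k = 1")
        case False
        then show ?thesis using that anti[of 1 "N - Suc k"] by (simp add: less_imp_le)
      qed simp
      then show "x (N - Suc k) < x N + int L" using first by simp
    qed
    ultimately show ?thesis by (fastforce simp: inc_lists_def ys_def)
  qed
  moreover have "x = config_of N (x N) ys"
  proof
    fix i
    show "x i = config_of N (x N) ys i"
    proof (cases "i \<in> {1..N}")
      case True
      then have "N - i < N" "N - (N - i) = i" by auto
      then show ?thesis using True nth[of "N - i"] by (simp add: config_of_def)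
    next
      case False
      then show ?thesis using assms by (auto simp: configs_def config_of_def extensional_def)
    qed
  qed
  ultimately show ?thesis by (rule that)
qed

lemma config_of_inject:
  assumes "1 \<le> N" "length ys = N - 1" "length zs = N - 1" "config_of N s ys = config_of N t zs"
  shows "s = t" "ys = zs"
proof -
  have e: "s + (0 # ys) ! k = t + (0 # zs) ! k" if "k < N" for k
    using config_of_nth[OF that] assms(4) by metis
  from e[of 0] assms(1) show "s = t" by simp
  then have "ys ! k = zs ! k" if "k < N - 1" for k using e[of "Suc k"] that by simp
  then show "ys = zs" using assms by (intro nth_equalityI) auto
qed

lemma det1_cong:
  assumes "\<And>i j. i < N \<Longrightarrow> j < N \<Longrightarrow> a (Suc i) (Suc j) = b i j"
  shows "det1 N a = det (mat N N (\<lambda>(i, j). b i j))"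
  unfolding det1_def by (rule arg_cong[where f = det]) (auto simp: assms)

lemma speed_factor_prod:
  assumes "1 \<le> N" "length ys = N - 1"
  shows "(\<Prod>i = 1..N. 1 - c * of_bool (with_x0 N L (config_of N t ys) (i - 1) - config_of N t ys i = 1))
    = gap_weight c (int L) (0 # ys)"
proof -
  have len: "length (0 # ys) = N" using assms by simp
  have "gap_weight c (int L) (0 # ys)
      = (\<Prod>k<N. 1 - c * of_bool (((0 # ys) @ [int L]) ! Suc k - (0 # ys) ! k = 1))"
    unfolding gap_weight_def len ..
  also have "\<dots> = (\<Prod>i = 1..N. 1 - c * of_bool (with_x0 N L (config_of N t ys) (i - 1) - config_of N t ys i = 1))"
  proof (rule prod.reindex_bij_witness[of _ "\<lambda>i. N - i" "\<lambda>k. N - k"])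
    fix k assume "k \<in> {..<N}"
    then have k: "k < N" by simp
    have "with_x0 N L (config_of N t ys) (N - k - 1) = t + ((0 # ys) @ [int L]) ! Suc k"
    proof (cases "Suc k = N")
      case True
      then show ?thesis
        using config_of_nth[of 0 N t ys] assms len by (simp add: with_x0_def nth_append)
    next
      case False
      then have "Suc k < N" using k by simp
      then show ?thesis
        using config_of_nth[of "Suc k" N t ys] len by (simp add: with_x0_def nth_append)
    qed
    then show "1 - c * of_bool (with_x0 N L (config_of N t ys) (N - k - 1) - config_of N t ys (N - k) = 1)
        = 1 - c * of_bool (((0 # ys) @ [int L]) ! Suc k - (0 # ys) ! k = 1)"
      using config_of_nth[OF k, of t ys] by simp
  qed auto
  finally show ?thesis by simp
qed

lemma geometric_has_sum:
  assumes "norm (q :: complex) < 1"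
  shows "((\<lambda>t. q ^ t) has_sum 1 / (1 - q)) UNIV"
  by (rule norm_summable_imp_has_sum)
    (use assms geometric_sums[OF assms] in \<open>auto simp: norm_power summable_geometric\<close>)

section \<open>The summation formula\<close>

theorem proposition5p4:
  fixes N L :: nat and p :: real and z z' :: complex and w w' :: "nat \<Rightarrow> complex"
  assumes "1 \<le> N" and "N < L"
    and "0 < p" and "p < 1"
    and "z \<noteq> 0" and "z' \<noteq> 0" and "z' ^ L \<noteq> z ^ L"
    and "\<forall>i\<in>{1..N}. w i \<in> bethe_roots p N L z"
    and "\<forall>i\<in>{1..N}. w' i \<in> bethe_roots p N L z'"
    and "(\<Prod>j = 1..N. cmod (w j + 1)) > (\<Prod>j = 1..N. cmod (w' j + 1))"
  shows "((\<lambda>x. Psi_r p N L x w * Psi_l p N x w') has_sum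
           ((1 - (z' / z) ^ L) ^ (N - 1) * (\<Prod>j = 1..N. w j + 1)
             * det1 N (\<lambda>i i'. 1 / (w i - w' i'))))
         {x \<in> configs N L. x N \<ge> 0}"
proof -
  define c where "c = complex_of_real p"
  \<comment> \<open>The identities of the locale are required at all indices; repeating a root extends the
    family to them.\<close>
  define u where "u i = (if i < N then w (Suc i) else w 1)" for i
  define v where "v i = (if i < N then w' (Suc i) else w' 1)" for i
  \<comment> \<open>If \<open>1 + c b\<close> vanished, the Bethe equation would force \<open>b = 0\<close> or \<open>b = -1\<close>, where
    \<open>1 + c b\<close> is \<open>1\<close> or \<open>1 - p\<close>.\<close>
  have root: "regular c b" "mode c N (int L) b = \<zeta> ^ L" if "b \<in> bethe_roots p N L \<zeta>" "\<zeta> \<noteq> 0" for b \<zeta>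
  proof -
    have e: "b ^ N * (1 + b) ^ (L - N) = \<zeta> ^ L * (1 + c * b) ^ N"
      using that by (simp add: bethe_roots_def c_def)
    have p: "c \<noteq> 0" "c \<noteq> 1" using assms(3,4) by (auto simp: c_def)
    have "1 + c * b \<noteq> 0"
    proof
      assume d: "1 + c * b = 0"
      then have "b ^ N * (1 + b) ^ (L - N) = 0" using e assms(1) by simp
      then have "b = 0 \<or> 1 + b = 0" by auto
      then show False
      proof
        assume "1 + b = 0"
        then have "b = -1" by (simp add: add_eq_0_iff)
        then show False using d p by simp
      qed (use d in simp)
    qed
    moreover from this have "b ^ N * (1 + b) ^ (L - N) \<noteq> 0" using e that by simp
    ultimately show r: "regular c b"
      using assms(1,2) by (auto simp: regular_def)
    have "mode c N (int L) b = b ^ N * (1 + b) ^ (L - N) / (1 + c * b) ^ N"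
      using assms(2) by (simp add: mode_def power_divide of_nat_diff[symmetric] del: of_nat_diff)
    then show "mode c N (int L) b = \<zeta> ^ L" using e r by (simp add: regular_def)
  qed
  have mem_u: "u i \<in> bethe_roots p N L z" and mem_v: "v i \<in> bethe_roots p N L z'" for i
    using assms(1,8,9) by (auto simp: u_def v_def)
  interpret periodic_mode_pair c u v N "int L" "z ^ L" "z' ^ L"
  proof
    \<comment> \<open>A common root of both equations would give \<open>z\<^sup>L = z'\<^sup>L\<close>.\<close>
    show "u i \<noteq> v j" for i j
      using root(2)[OF mem_u[of i]] root(2)[OF mem_v[of j]] assms(5-7) by auto
    show "regular c (u i)" "mode c N (int L) (u i) = z ^ L" for i
      using root[OF mem_u assms(5)] by blast+
    show "regular c (v i)" "mode c N (int L) (v i) = z' ^ L" for i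
      using root[OF mem_v assms(6)] by blast+
  qed (use assms in auto)
  define q where "q = (\<Prod>i<N. 1 + v i) / (\<Prod>i<N. 1 + u i)"
  have prod_u: "(\<Prod>j = 1..N. w j + 1) = (\<Prod>i<N. 1 + u i)"
    by (simp add: prod.atLeast1_atMost_eq u_def add.commute)
  have "(\<Prod>j<N. cmod (u j + 1)) > (\<Prod>j<N. cmod (v j + 1))"
    using assms(10) by (simp add: prod.atLeast1_atMost_eq u_def v_def)
  moreover have nz: "(\<Prod>i<N. 1 + u i) \<noteq> 0" using regular_u by (auto simp: regular_def)
  moreover have "(\<Prod>j<N. cmod (u j + 1)) > 0"
    using regular_u by (intro prod_pos) (auto simp: regular_def add.commute)
  ultimately have q: "norm q < 1"
    by (simp add: q_def norm_divide prod_norm[symmetric] add.commute)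
  define F where "F ys = gap_weight c (int L) (0 # ys) * (det_psi (0 # ys) * det_phi (0 # ys))" for ys
  have summand: "Psi_r p N L (config_of N (int t) ys) w * Psi_l p N (config_of N (int t) ys) w' = q ^ t * F ys"
    if "ys \<in> inc_lists (N - 1) 1 (int L)" for t ys
  proof -
    let ?x = "config_of N (int t) ys"
    have "Psi_l p N ?x w' = det (mat N N (\<lambda>(i, j). (1 + v i) ^ t * phi j ((0 # ys) ! j) i))"
      unfolding Psi_l_def
    proof (rule det1_cong)
      fix i j assume ij: "i < N" "j < N"
      have "(1 + v i) ^ t * phi j ((0 # ys) ! j) i = mode c j ((0 # ys) ! j + int t) (v i)"
        by (simp add: phi_def mode_add[OF regular_v])
      then show "(w' (Suc i) / (1 + complex_of_real p * w' (Suc i))) powi (int (Suc j) - 1)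
          * (1 + w' (Suc i)) powi (?x (N + 1 - Suc j) - int (Suc j) + 1)
          = (1 + v i) ^ t * phi j ((0 # ys) ! j) i"
        using ij config_of_nth[OF ij(2), of "int t" ys]
        by (simp add: mode_def v_def c_def algebra_simps)
    qed
    then have l: "Psi_l p N ?x w' = (\<Prod>i<N. 1 + v i) ^ t * det_phi (0 # ys)"
      by (simp only: det_scale_rows prod_power_distrib det_phi_def)
    have "det1 N (\<lambda>i j. (w i / (1 + complex_of_real p * w i)) powi (1 - int j)
           * (1 + w i) powi (- ?x (N + 1 - j) + int j - 1))
        = det (mat N N (\<lambda>(i, j). (1 / (1 + u i) ^ t) * psi j ((0 # ys) ! j) i))"
    proof (rule det1_cong)
      fix i j assume ij: "i < N" "j < N"
      have "(1 / (1 + u i) ^ t) * psi j ((0 # ys) ! j) i = 1 / mode c j ((0 # ys) ! j + int t) (u i)"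
        by (simp add: psi_def mode_add[OF regular_u])
      also have "\<dots> = (u i / (1 + c * u i)) powi (- int j) * (1 + u i) powi (- ((0 # ys) ! j + int t - int j))"
        unfolding mode_def power_int_minus by (simp add: field_simps)
      finally show "(w (Suc i) / (1 + complex_of_real p * w (Suc i))) powi (1 - int (Suc j))
          * (1 + w (Suc i)) powi (- ?x (N + 1 - Suc j) + int (Suc j) - 1)
          = (1 / (1 + u i) ^ t) * psi j ((0 # ys) ! j) i"
        using ij config_of_nth[OF ij(2), of "int t" ys]
        by (simp add: u_def c_def algebra_simps)
    qed
    also have "\<dots> = (\<Prod>i<N. 1 / (1 + u i) ^ t) * det_psi (0 # ys)"
      by (simp only: det_scale_rows det_psi_def)
    also have "(\<Prod>i<N. 1 / (1 + u i) ^ t) = 1 / (\<Prod>i<N. 1 + u i) ^ t"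
      by (simp add: prod_dividef prod_power_distrib)
    finally have "Psi_r p N L ?x w
        = gap_weight c (int L) (0 # ys) * (1 / (\<Prod>i<N. 1 + u i) ^ t * det_psi (0 # ys))"
      unfolding Psi_r_def using speed_factor_prod[of N ys c L "int t"] that assms(1)
      by (simp add: inc_lists_def c_def)
    then show ?thesis
      unfolding l by (simp add: F_def q_def power_divide)
  qed
  define B where "B ys = (\<lambda>t. config_of N (int t) ys) ` (UNIV :: nat set)" for ys
  have "((\<lambda>x. Psi_r p N L x w * Psi_l p N x w') has_sum (\<Sum>ys\<in>inc_lists (N - 1) 1 (int L). F ys / (1 - q)))
      (\<Union>ys\<in>inc_lists (N - 1) 1 (int L). B ys)"
  proof (rule sum_has_sum[OF finite_inc_lists])
    fix ys assume ys: "ys \<in> inc_lists (N - 1) 1 (int L)"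
    have "length ys = N - 1" using ys by (simp add: inc_lists_def)
    then have "inj (\<lambda>t. config_of N (int t) ys)"
      using config_of_inject(1)[OF assms(1), of ys ys] by (intro injI) (metis of_nat_eq_iff)
    moreover have "((\<lambda>t. q ^ t * F ys) has_sum (1 / (1 - q) * F ys)) UNIV"
      by (rule has_sum_cmult_left[OF geometric_has_sum[OF q]])
    ultimately show "((\<lambda>x. Psi_r p N L x w * Psi_l p N x w') has_sum F ys / (1 - q)) (B ys)"
      unfolding B_def by (subst has_sum_reindex) (simp_all add: o_def summand[OF ys])
  next
    fix ys zs assume "ys \<in> inc_lists (N - 1) 1 (int L)" "zs \<in> inc_lists (N - 1) 1 (int L)" and ne: "ys \<noteq> zs"
    then have "length ys = N - 1" "length zs = N - 1" by (simp_all add: inc_lists_def)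
    from config_of_inject(2)[OF assms(1) this] ne
    have "config_of N s ys \<noteq> config_of N t zs" for s t by blast
    then show "B ys \<inter> B zs = {}" by (auto simp: B_def)
  qed
  also have "(\<Union>ys\<in>inc_lists (N - 1) 1 (int L). B ys) = {x \<in> configs N L. x N \<ge> 0}"
  proof (intro equalityI subsetI)
    fix x assume "x \<in> (\<Union>ys\<in>inc_lists (N - 1) 1 (int L). B ys)"
    then obtain ys t where "ys \<in> inc_lists (N - 1) 1 (int L)" "x = config_of N (int t) ys"
      by (auto simp: B_def)
    then show "x \<in> {x \<in> configs N L. x N \<ge> 0}"
      using config_of_mem[OF assms(1,2)] config_of_nth[of 0 N "int t" ys] assms(1) by simp
  next
    fix x assume x: "x \<in> {x \<in> configs N L. x N \<ge> 0}"
    then obtain ys where ys: "ys \<in> inc_lists (N - 1) 1 (int L)" "x = config_of N (x N) ys"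
      using config_of_surj[OF assms(1)] by blast
    have "x = config_of N (int (nat (x N))) ys" using x ys(2) by simp
    then have "x \<in> B ys" unfolding B_def by blast
    with ys(1) show "x \<in> (\<Union>ys\<in>inc_lists (N - 1) 1 (int L). B ys)" by blast
  qed
  also have "(\<Sum>ys\<in>inc_lists (N - 1) 1 (int L). F ys / (1 - q))
      = (1 - (z' / z) ^ L) ^ (N - 1) * (\<Prod>j = 1..N. w j + 1) * det1 N (\<lambda>i i'. 1 / (w i - w' i'))"
  proof -
    have "det1 N (\<lambda>i i'. 1 / (w i - w' i')) = det (mat N N (\<lambda>(i, j). 1 / (u i - v j)))"
      by (rule det1_cong) (simp add: u_def v_def)
    moreover have "(\<Sum>ys\<in>inc_lists (N - 1) 1 (int L). F ys)
      = (1 - z' ^ L / z ^ L) ^ (N - 1) * ((\<Prod>i<N. 1 + u i) - (\<Prod>i<N. 1 + v i))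
         * det (mat N N (\<lambda>(i, j). 1 / (u i - v j)))"
      unfolding F_def by (rule sum_inc_lists)
    moreover have "(\<Prod>i<N. 1 + u i) - (\<Prod>i<N. 1 + v i) = (1 - q) * (\<Prod>i<N. 1 + u i)"
      using nz by (simp add: q_def left_diff_distrib)
    moreover have "1 - q \<noteq> 0" using q by auto
    ultimately show ?thesis
      unfolding prod_u by (simp add: sum_divide_distrib[symmetric] power_divide)
  qed
  finally show ?thesis .
qed

end
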